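(* Let $f(z)$ be a $\mathbb C^{2p\times2p}$-valued rational function, analytic at infinity, bicomplex $\sharp$-symmetric, and regular on the unit circle. Then $f$ admits a bicomplex $\sharp$-symmetric realization (centered at infinity) which is regular on the unit circle: there exist $n\in\mathbb N$ and bicomplex $\sharp$-symmetric matrices $A\in\mathbb C^{2n\times2n}$, $B\in\mathbb C^{2n\times2p}$, $C\in\mathbb C^{2p\times2n}$, $D\in\mathbb C^{2p\times2p}$ such that $f(z)=D+C(zI_{2n}-A)^{-1}B$ and $A$ has no spectrum on the unit circle.
   Context: Let $J=\begin{pmatrix}0&-1\\1&0\end{pmatrix}$ and $J_a=J\otimes I_a$ (Kronecker product). For $M\in\mathbb C^{2a\times2b}$ put $M^\sharp=J_aMJ_b^*$; $M$ is called bicomplex $\sharp$-symmetric if $M=M^\sharp$. A rational $\mathbb C^{2p\times2p}$-valued function $f$ is bicomplex $\sharp$-symmetric if $f(z)=(f(z))^\sharp$ at every $z$ which is not a pole. $f$ is regular on the unit circle if it has no singularities there. A realization of $f$ centered at infinity is a representation $f(z)=D+C(zI_N-A)^{-1}B$ (not required to be minimal); it is called regular on the unit circle if $A$ has no spectrum on the unit circle, and (bicomplex) $\sharp$-symmetric if $A,B,C,D$ are. *)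

theory Defs
  imports
    "HOL-Complex_Analysis.Complex_Analysis"
    "Jordan_Normal_Form.Spectral_Radius"
    "Jordan_Normal_Form.Schur_Decomposition"
    "Jordan_Normal_Form.Gauss_Jordan_Elimination"
begin

definition kronecker_mat :: "'a :: semiring_0 mat \<Rightarrow> 'a mat \<Rightarrow> 'a mat" where
  "kronecker_mat M K = mat (dim_row M * dim_row K) (dim_col M * dim_col K)
     (\<lambda>(i, j). M $$ (i div dim_row K, j div dim_col K) * K $$ (i mod dim_row K, j mod dim_col K))"

definition J_mat :: "nat \<Rightarrow> complex mat" where
  "J_mat a = kronecker_mat (mat_of_rows_list 2 [[0, -1], [1, 0]]) (1\<^sub>m a)"

definition sharp :: "nat \<Rightarrow> nat \<Rightarrow> complex mat \<Rightarrow> complex mat" where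
  "sharp a b M = J_mat a * M * mat_adjoint (J_mat b)"

definition sharp_symmetric :: "nat \<Rightarrow> nat \<Rightarrow> complex mat \<Rightarrow> bool" where
  "sharp_symmetric a b M \<longleftrightarrow> M \<in> carrier_mat (2 * a) (2 * b) \<and> M = sharp a b M"

text \<open>A rational function is represented by a total function on the complex plane which agrees
  with a quotient of polynomials in lowest terms wherever the denominator does not vanish. Lowest
  terms ensure that the value is the right one at every point that is not a pole; the values at the
  poles are arbitrary and are never used.\<close>

definition rational_fun :: "(complex \<Rightarrow> complex) \<Rightarrow> bool" where
  "rational_fun g \<longleftrightarrow> (\<exists>P Q. Q \<noteq> 0 \<and> coprime P Q \<and>
     (\<forall>z. poly Q z \<noteq> 0 \<longrightarrow> g z = poly P z / poly Q z))"

definition rational_mat_fun :: "nat \<Rightarrow> nat \<Rightarrow> (complex \<Rightarrow> complex mat) \<Rightarrow> bool" where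
  "rational_mat_fun r c f \<longleftrightarrow> (\<forall>z. f z \<in> carrier_mat r c) \<and>
     (\<forall>i<r. \<forall>j<c. rational_fun (\<lambda>z. f z $$ (i, j)))"

definition pole_mat_fun :: "nat \<Rightarrow> nat \<Rightarrow> (complex \<Rightarrow> complex mat) \<Rightarrow> complex \<Rightarrow> bool" where
  "pole_mat_fun r c f z \<longleftrightarrow> (\<exists>i<r. \<exists>j<c. is_pole (\<lambda>w. f w $$ (i, j)) z)"

text \<open>Analyticity at infinity: after the substitution \<open>z = 1 / w\<close> every entry extends analytically
  to \<open>w = 0\<close>.\<close>

definition analytic_at_infinity_mat :: "nat \<Rightarrow> nat \<Rightarrow> (complex \<Rightarrow> complex mat) \<Rightarrow> bool" where
  "analytic_at_infinity_mat r c f \<longleftrightarrow> (\<forall>i<r. \<forall>j<c. \<exists>g. g analytic_on {0} \<and>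
     (\<forall>\<^sub>F w in at 0. f (1 / w) $$ (i, j) = g w))"

definition sharp_symmetric_fun :: "nat \<Rightarrow> (complex \<Rightarrow> complex mat) \<Rightarrow> bool" where
  "sharp_symmetric_fun p f \<longleftrightarrow>
     (\<forall>z. \<not> pole_mat_fun (2 * p) (2 * p) f z \<longrightarrow> sharp_symmetric p p (f z))"

definition regular_on_circle :: "nat \<Rightarrow> nat \<Rightarrow> (complex \<Rightarrow> complex mat) \<Rightarrow> bool" where
  "regular_on_circle r c f \<longleftrightarrow> (\<forall>z\<in>sphere 0 1. \<not> pole_mat_fun r c f z)"

text \<open>The resolvent exists exactly off the spectrum of the state matrix. As realizations need not be
  minimal, the spectrum may contain points that are not poles of \<open>f\<close>; the identity is
  the one between rational functions, hence required at every point off the spectrum.\<close>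

definition realization ::
    "nat \<Rightarrow> (complex \<Rightarrow> complex mat) \<Rightarrow> complex mat \<Rightarrow> complex mat \<Rightarrow> complex mat \<Rightarrow> complex mat \<Rightarrow> bool"
  where
  "realization N f A B C D \<longleftrightarrow>
     (\<forall>z. z \<notin> spectrum A \<longrightarrow> f z = D + C * the (mat_inverse (z \<cdot>\<^sub>m 1\<^sub>m N - A)) * B)"

end

theory Submission
  imports Defs
begin

text \<open>The map \<open>M \<mapsto> M\<^sup>\<sharp>\<close> is complex linear, and \<open>M = M\<^sup>\<sharp>\<close> says that \<open>M\<close> has the block form
  \<open>[[X, -Y], [Y, X]]\<close>. Write \<open>f = P / Q\<close> with a common monic scalar denominator \<open>Q\<close> of degree
  \<open>d > 0\<close>; regularity on the circle lets us choose \<open>Q\<close> without zeros there, and analyticity at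
  infinity gives \<open>degree P \<le> d\<close>. By the identity theorem the coefficients of the matrix polynomial
  \<open>P\<close> inherit the symmetry of \<open>f\<close>. The realization is the block companion one: the state matrix is
  \<open>A = I \<otimes> companion Q\<close>, whose spectrum is the zero set of \<open>Q\<close>; the input matrix is \<open>I \<otimes> e\<close>
  with \<open>e\<close> the last unit vector; and the output matrix lists the coefficients of \<open>P - f(\<infinity>) Q\<close>.
  Placing the factor \<open>I\<close> on the left makes \<open>A\<close> and \<open>B\<close> commute with \<open>J\<close>.\<close>

section \<open>Entrywise form of the symmetry\<close>

lemma J_mat_carrier [simp]: "J_mat a \<in> carrier_mat (2 * a) (2 * a)"
  unfolding J_mat_def kronecker_mat_def mat_of_rows_list_def by (intro carrier_matI) simp_all

text \<open>\<open>J_mat a\<close> is a signed permutation matrix exchanging the two halves of the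
  index range, so multiplying by it only moves entries and changes signs.\<close>

lemma J_mat_index:
  assumes "i < 2 * a" "k < 2 * a"
  shows "J_mat a $$ (i, k) =
    (if k = (if i < a then i + a else i - a) then if i < a then - 1 else 1 else 0)"
proof -
  have div_mod: "j div a = (if j < a then 0 else 1)" "j mod a = (if j < a then j else j - a)"
    if "j < 2 * a" for j
    using that by (auto simp: div_if mod_if)
  have "J_mat a $$ (i, k) = mat_of_rows_list 2 [[0, -1], [1, 0 :: complex]] $$ (i div a, k div a)
      * 1\<^sub>m a $$ (i mod a, k mod a)"
    using assms unfolding J_mat_def kronecker_mat_def
    by (simp add: mat_of_rows_list_def)
  then show ?thesis
    using assms by (auto simp: div_mod mat_of_rows_list_def)
qed

lemma mat_adjoint_index:
  fixes M :: "complex mat"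
  assumes "i < dim_col M" "j < dim_row M"
  shows "mat_adjoint M $$ (i, j) = cnj (M $$ (j, i))"
  using assms unfolding mat_adjoint_def by (simp add: mat_of_rows_index)

lemma mat_adjoint_carrier:
  assumes "M \<in> carrier_mat r c"
  shows "mat_adjoint M \<in> carrier_mat c r"
  using assms unfolding mat_adjoint_def by (auto simp: mat_of_rows_def)

lemma sharp_carrier:
  "M \<in> carrier_mat (2 * a) (2 * b) \<Longrightarrow> sharp a b M \<in> carrier_mat (2 * a) (2 * b)"
  unfolding sharp_def by (meson J_mat_carrier mat_adjoint_carrier mult_carrier_mat)

text \<open>Both matrix products collapse to a single term. The entries of \<open>J_mat b\<close>
  are real, so its adjoint brings in no conjugation and the map is complex linear.\<close>

lemma sharp_index:
  assumes M: "M \<in> carrier_mat (2 * a) (2 * b)" and i: "i < 2 * a" and j: "j < 2 * b"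
  shows "sharp a b M $$ (i, j) = (if i < a then - 1 else 1) * (if j < b then - 1 else 1) *
    M $$ (if i < a then i + a else i - a, if j < b then j + b else j - b)"
proof -
  let ?s = "if i < a then i + a else i - a" and ?t = "if j < b then j + b else j - b"
  have st: "?s < 2 * a" "?t < 2 * b" using i j by auto
  have dims: "dim_row (J_mat c) = 2 * c" "dim_col (J_mat c) = 2 * c" for c
    using J_mat_carrier[of c] by blast+
  have JM: "(J_mat a * M) $$ (i, l) = (if i < a then - 1 else 1) * M $$ (?s, l)"
    if l: "l < 2 * b" for l
  proof -
    have "(J_mat a * M) $$ (i, l) = (\<Sum>k = 0..<2 * a. J_mat a $$ (i, k) * M $$ (k, l))"
      using i l M by (auto simp: scalar_prod_def dims)
    also have "\<dots> = (\<Sum>k = 0..<2 * a. if k = ?s then (if i < a then - 1 else 1) * M $$ (k, l) else 0)"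
      using i by (intro sum.cong) (auto simp: J_mat_index)
    also have "\<dots> = (if i < a then - 1 else 1) * M $$ (?s, l)"
      using st by (simp add: sum.delta)
    finally show ?thesis .
  qed
  have "sharp a b M $$ (i, j) =
      (\<Sum>l = 0..<2 * b. (J_mat a * M) $$ (i, l) * mat_adjoint (J_mat b) $$ (l, j))"
    unfolding sharp_def using i j M mat_adjoint_carrier[OF J_mat_carrier[of b]]
    by (auto simp: scalar_prod_def dims)
  also have "\<dots> = (\<Sum>l = 0..<2 * b. if l = ?t then (if i < a then - 1 else 1) *
      M $$ (?s, l) * (if j < b then - 1 else 1) else 0)"
    using j by (intro sum.cong) (auto simp: JM mat_adjoint_index dims J_mat_index)
  also have "\<dots> = (if i < a then - 1 else 1) * M $$ (?s, ?t) * (if j < b then - 1 else 1)"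
    using st by (simp add: sum.delta)
  finally show ?thesis by (simp only: mult_ac)
qed

text \<open>The map pairs diagonal blocks with each other and off-diagonal blocks with each other,
  so two equations indexed by the first halves cover all four blocks.\<close>

lemma sharp_symmetric_iff_entries:
  "sharp_symmetric a b M \<longleftrightarrow> M \<in> carrier_mat (2 * a) (2 * b) \<and>
    (\<forall>i<a. \<forall>j<b. M $$ (i + a, j + b) = M $$ (i, j) \<and> M $$ (i + a, j) = - M $$ (i, j + b))"
  (is "_ \<longleftrightarrow> ?car \<and> ?ent")
proof (cases ?car)
  case True
  have "M = sharp a b M \<longleftrightarrow> (\<forall>i<2 * a. \<forall>j<2 * b. M $$ (i, j) = sharp a b M $$ (i, j))"
    using True sharp_carrier[OF True] by (auto intro!: eq_matI)
  also have "\<dots> \<longleftrightarrow> ?ent"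
  proof (intro iffI allI impI)
    fix i j assume *: "\<forall>i<2 * a. \<forall>j<2 * b. M $$ (i, j) = sharp a b M $$ (i, j)" and ij: "i < a" "j < b"
    have "M $$ (i, j) = sharp a b M $$ (i, j)" "M $$ (i + a, j) = sharp a b M $$ (i + a, j)"
      using ij by (intro *[rule_format]; simp)+
    then show "M $$ (i + a, j + b) = M $$ (i, j) \<and> M $$ (i + a, j) = - M $$ (i, j + b)"
      using True ij by (simp add: sharp_index)
  next
    fix i j assume *: ?ent and ij: "i < 2 * a" "j < 2 * b"
    have "(if i < a then i else i - a) < a" "(if j < b then j else j - b) < b"
      using ij by auto
    from *[rule_format, OF this] show "M $$ (i, j) = sharp a b M $$ (i, j)"
      using True ij by (cases "i < a"; cases "j < b") (simp_all add: sharp_index)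
  qed
  finally show ?thesis using True unfolding sharp_symmetric_def by blast
qed (auto simp: sharp_symmetric_def)

section \<open>Rational functions\<close>

lemma eventually_poly_nonzero:
  fixes Q :: "complex poly"
  assumes "Q \<noteq> 0"
  shows "\<forall>\<^sub>F z in at a. poly Q z \<noteq> 0"
proof -
  have "\<forall>\<^sub>F z in at a. z \<notin> {x. poly Q x = 0} - {a}"
    using poly_roots_finite[OF assms]
    by (intro eventually_at_topological[THEN iffD2] exI[of _ "- ({x. poly Q x = 0} - {a})"]
        conjI open_Compl finite_imp_closed finite_Diff) auto
  moreover have "\<forall>\<^sub>F z in at a. z \<noteq> a"
    by (simp add: eventually_at_filter)
  ultimately show ?thesis by eventually_elim auto
qed

text \<open>In lowest terms the numerator cannot vanish at a root of the denominator. This turns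
  regularity on the circle into a statement about denominators.\<close>

lemma rational_is_pole_at_root:
  assumes "Q \<noteq> 0" "coprime P Q" and g: "\<And>z. poly Q z \<noteq> 0 \<Longrightarrow> g z = poly P z / poly Q z"
    and root: "poly Q z = (0 :: complex)"
  shows "is_pole g z"
proof -
  have "poly P z \<noteq> 0"
  proof
    assume "poly P z = 0"
    then have "[:- z, 1:] dvd P" "[:- z, 1:] dvd Q"
      using root by (simp_all add: poly_eq_0_iff_dvd)
    then have "is_unit [:- z, 1:]"
      using \<open>coprime P Q\<close> coprime_common_divisor by blast
    then show False by (simp add: is_unit_pCons_iff)
  qed
  moreover have "isCont (poly Q) z" by simp
  then have "(poly Q \<longlongrightarrow> 0) (at z)"
    using root by (simp add: isCont_def)
  then have "filterlim (poly Q) (at 0) (at z)"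
    using eventually_poly_nonzero[OF \<open>Q \<noteq> 0\<close>] by (simp add: filterlim_at)
  ultimately have "is_pole (\<lambda>z. poly P z / poly Q z) z"
    by (intro is_pole_divide) auto
  moreover have "\<forall>\<^sub>F w in at z. g w = poly P w / poly Q w"
    using eventually_poly_nonzero[OF \<open>Q \<noteq> 0\<close>] by eventually_elim (rule g)
  ultimately show ?thesis
    by (simp add: is_pole_cong[where f = g])
qed

text \<open>Stated for an arbitrary quotient because it is applied to the common denominator, where
  the fractions may be unreduced.\<close>

lemma rational_not_is_pole:
  assumes g: "\<And>z. poly Q z \<noteq> 0 \<Longrightarrow> g z = poly P z / poly Q z" and "poly Q z \<noteq> (0 :: complex)"
  shows "\<not> is_pole g z"
proof -
  have "(\<lambda>z. poly P z / poly Q z) analytic_on {z}"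
    using assms(2) holomorphic_on_imp_analytic_at[OF poly_holomorphic_on[OF holomorphic_on_id] open_UNIV]
    by (intro analytic_on_divide) (auto simp: id_def)
  then have "\<not> is_pole (\<lambda>z. poly P z / poly Q z) z"
    by (rule analytic_at_imp_no_pole)
  moreover have "Q \<noteq> 0" using assms(2) by auto
  then have "\<forall>\<^sub>F w in at z. g w = poly P w / poly Q w"
    by (rule eventually_mono[OF eventually_poly_nonzero g])
  ultimately show ?thesis
    by (simp add: is_pole_cong[where f = g])
qed

text \<open>Substituting \<open>1 / w\<close> turns \<open>P\<close> and \<open>Q\<close> into their
  reflected polynomials. An excess \<open>e\<close> in degree would leave a factor
  \<open>w ^ e\<close>, forcing \<open>reflect_poly P\<close> to vanish at \<open>0\<close>.\<close>

lemma rational_degree_le: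
  fixes g h :: "complex \<Rightarrow> complex"
  assumes "Q \<noteq> 0" and g: "\<And>z. poly Q z \<noteq> 0 \<Longrightarrow> g z = poly P z / poly Q z"
    and h: "h analytic_on {0}" "\<forall>\<^sub>F w in at 0. g (1 / w) = h w"
  shows "degree P \<le> degree Q"
proof (rule ccontr)
  assume "\<not> degree P \<le> degree Q"
  then have less: "degree Q < degree P" by simp
  define e where "e = degree P - degree Q"
  have e: "e > 0" "degree P = e + degree Q" using less by (auto simp: e_def)
  have "reflect_poly Q \<noteq> 0" using \<open>Q \<noteq> 0\<close> by simp
  from eventually_poly_nonzero[OF this, of 0] h(2) eventually_neq_at_within[of 0 0 UNIV]
  have ev: "\<forall>\<^sub>F w in at 0. poly (reflect_poly P) w = w ^ e * poly (reflect_poly Q) w * h w"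
  proof eventually_elim
    case (elim w)
    then have "poly Q (1 / w) \<noteq> 0"
      by (auto simp: poly_reflect_poly_nz inverse_eq_divide)
    then have "poly P (1 / w) = poly Q (1 / w) * h w"
      using g[of "1 / w"] elim(2) by simp
    then show ?case
      using elim(3) by (simp add: poly_reflect_poly_nz inverse_eq_divide e power_add)
  qed
  have "isCont h 0" using h(1) by (rule analytic_at_imp_isCont)
  then have "((\<lambda>w. w ^ e * poly (reflect_poly Q) w * h w) \<longlongrightarrow> 0 ^ e * poly (reflect_poly Q) 0 * h 0) (at 0)"
    by (intro tendsto_intros) (auto simp: isCont_def)
  then have "(poly (reflect_poly P) \<longlongrightarrow> 0) (at 0)"
    using e(1) by (simp add: tendsto_cong[OF ev] zero_power)
  moreover have "isCont (poly (reflect_poly P)) 0" by simp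
  then have "(poly (reflect_poly P) \<longlongrightarrow> poly (reflect_poly P) 0) (at 0)"
    by (simp only: isCont_def)
  ultimately have "poly (reflect_poly P) 0 = 0"
    using tendsto_unique trivial_limit_at by blast
  \<comment> \<open>The value of \<open>reflect_poly P\<close> at \<open>0\<close> is the leading
    coefficient of \<open>P\<close>, and \<open>P\<close> is nonzero because its degree is
    positive.\<close>
  then show False using less by auto
qed


text \<open>The product of all reduced denominators serves. Each factor is free of zeros on the
  circle, since a zero would be a pole of an entry; passing to the product multiplies numerator and
  denominator by the same cofactor, which preserves the degree bound.\<close>

lemma rational_mat_fun_common_denominator:
  assumes "rational_mat_fun r c f" "analytic_at_infinity_mat r c f" "regular_on_circle r c f"
  obtains P Q where "monic Q" "degree Q > 0"
    and "\<And>i j. i < r \<Longrightarrow> j < c \<Longrightarrow> degree (P i j) \<le> degree Q"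
    and "\<And>i j z. i < r \<Longrightarrow> j < c \<Longrightarrow> poly Q z \<noteq> 0 \<Longrightarrow> f z $$ (i, j) = poly (P i j) z / poly Q z"
    and "\<And>z. z \<in> sphere 0 1 \<Longrightarrow> poly Q z \<noteq> 0"
proof -
  define ok where "ok i j P Q \<longleftrightarrow> Q \<noteq> 0 \<and> coprime P Q \<and>
    (\<forall>z. poly Q z \<noteq> 0 \<longrightarrow> f z $$ (i, j) = poly P z / poly Q z)" for i j and P Q :: "complex poly"
  have "\<forall>i j. \<exists>P Q. i < r \<longrightarrow> j < c \<longrightarrow> ok i j P Q"
    using assms(1) unfolding rational_mat_fun_def rational_fun_def ok_def by blast
  then obtain P Q where "\<forall>i j. i < r \<longrightarrow> j < c \<longrightarrow> ok i j (P i j) (Q i j)"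
    by metis
  then have Q0: "Q i j \<noteq> 0" and cop: "coprime (P i j) (Q i j)"
    and f: "\<And>z. poly (Q i j) z \<noteq> 0 \<Longrightarrow> f z $$ (i, j) = poly (P i j) z / poly (Q i j) z"
    if "i < r" "j < c" for i j
    using that unfolding ok_def by blast+
  have deg: "degree (P i j) \<le> degree (Q i j)" if ij: "i < r" "j < c" for i j
    using assms(2) ij rational_degree_le[OF Q0[OF ij] f[OF ij]]
    unfolding analytic_at_infinity_mat_def by blast
  have circle: "poly (Q i j) z \<noteq> 0" if ij: "i < r" "j < c" and z: "z \<in> sphere 0 1" for i j z
    using assms(3) z rational_is_pole_at_root[OF Q0[OF ij] cop[OF ij] f[OF ij]] ij
    unfolding regular_on_circle_def pole_mat_fun_def by blast
  define I where "I = {..<r} \<times> {..<c}"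
  have I: "finite I" "\<And>i j. (i, j) \<in> I \<longleftrightarrow> i < r \<and> j < c" by (auto simp: I_def)
  define R where "R = (\<Prod>(i, j)\<in>I. Q i j)"
  have R0: "R \<noteq> 0"
    using I Q0 by (auto simp: R_def)
  \<comment> \<open>The factor \<open>[:0, 1:]\<close> makes the degree positive even if \<open>f\<close> is constant.\<close>
  define q where "q = Polynomial.smult (inverse (lead_coeff R)) ([:0, 1:] * R)"
  \<comment> \<open>The cofactor by which the fraction at \<open>(i, j)\<close> is expanded.\<close>
  define S where "S i j = Polynomial.smult (inverse (lead_coeff R)) ([:0, 1:] * (\<Prod>(k, l)\<in>I - {(i, j)}. Q k l))"
    for i j
  have q: "q = S i j * Q i j" if "i < r" "j < c" for i j
    using I that prod.remove[of I "(i, j)" "\<lambda>(k, l). Q k l"] by (simp add: q_def S_def R_def mult_ac)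
  have q0: "q \<noteq> 0" using R0 by (simp add: q_def)
  show thesis
  proof (rule that[of q "\<lambda>i j. S i j * P i j"])
    have "lead_coeff q = inverse (lead_coeff R) * (lead_coeff [:0, 1:] * lead_coeff R)"
      unfolding q_def lead_coeff_smult lead_coeff_mult ..
    then show "monic q" using R0 by simp
    have "degree q = 1 + degree R" using R0 by (simp add: q_def degree_mult_eq)
    then show "degree q > 0" by simp
  next
    fix i j assume ij: "i < r" "j < c"
    have "degree q = degree (S i j) + degree (Q i j)"
      using q[OF ij] q0 by (auto simp: degree_mult_eq)
    then show "degree (S i j * P i j) \<le> degree q"
      using deg[OF ij] degree_mult_le[of "S i j" "P i j"] by linarith
    fix z assume "poly q z \<noteq> 0"
    then show "f z $$ (i, j) = poly (S i j * P i j) z / poly q z"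
      using f[OF ij] by (simp add: q[OF ij])
  next
    fix z :: complex assume z: "z \<in> sphere 0 1"
    then have "poly R z \<noteq> 0" "z \<noteq> 0"
      using I circle[OF _ _ z] by (auto simp: R_def poly_prod)
    then show "poly q z \<noteq> 0" using R0 by (simp add: q_def)
  qed
qed

section \<open>The block companion realization\<close>

lemma sum_lessThan_mult:
  fixes g :: "nat \<Rightarrow> 'a :: comm_monoid_add"
  shows "(\<Sum>t<r * d. g t) = (\<Sum>j<r. \<Sum>k<d. g (j * d + k))"
proof -
  have split: "(\<Sum>t<m + d. g t) = (\<Sum>t<m. g t) + (\<Sum>k<d. g (m + k))" for m
    by (induction d) (simp_all add: add.assoc)
  show ?thesis
    by (induction r) (simp_all add: split add.commute[of d])
qed

lemma mult_add_less_mult: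
  fixes i k :: nat
  assumes "i < r" "k < d"
  shows "i * d + k < r * d"
proof -
  have "i * d + k < Suc i * d" using assms by simp
  also have "\<dots> \<le> r * d" using assms by (intro mult_le_mono1) simp
  finally show ?thesis .
qed

lemma mult_add_less_mult_cases:
  fixes s :: nat
  assumes "s < r * d"
  obtains i k where "i < r" "k < d" "s = i * d + k"
proof (rule that[of "s div d" "s mod d"])
  have "d > 0" using assms by (cases d) auto
  then show "s div d < r" "s mod d < d" using assms by (simp_all add: div_less_iff_less_mult)
qed simp

section \<open>The block companion matrix and its spectrum\<close>

text \<open>An index \<open>i * d + k\<close> means position \<open>k\<close> in block
  \<open>i\<close>. In each block the ones stand above the diagonal and the coefficients in the last
  row, so that the powers of a root of a monic \<open>Q\<close> form an eigenvector.\<close>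

definition block_companion :: "nat \<Rightarrow> complex poly \<Rightarrow> complex mat" where
  "block_companion r Q = (let d = degree Q in mat (r * d) (r * d) (\<lambda>(s, t).
     if s div d = t div d
     then if Suc (s mod d) < d then if t mod d = Suc (s mod d) then 1 else 0 else - coeff Q (t mod d)
     else 0))"

lemma block_companion_carrier:
  "block_companion r Q \<in> carrier_mat (r * degree Q) (r * degree Q)"
  by (simp add: block_companion_def Let_def)

text \<open>Each row but the last of a block is a shift. Taking \<open>v\<close> as a function lets
  this serve both for vectors and for columns of a matrix.\<close>

lemma block_companion_row:
  fixes v :: "nat \<Rightarrow> complex"
  assumes d: "d = degree Q" and i: "i < r" and k: "k < d"
  shows "(\<Sum>t<r * d. block_companion r Q $$ (i * d + k, t) * v t) =
    (if Suc k < d then v (i * d + Suc k) else - (\<Sum>l<d. coeff Q l * v (i * d + l)))"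
proof -
  let ?e = "\<lambda>l. if Suc k < d then if l = Suc k then 1 else 0 else - coeff Q l"
  have "(\<Sum>t<r * d. block_companion r Q $$ (i * d + k, t) * v t) =
      (\<Sum>j<r. \<Sum>l<d. (if i = j then ?e l else 0) * v (j * d + l))"
    unfolding sum_lessThan_mult
    using mult_add_less_mult[of _ r _ d] i k
    by (intro sum.cong) (auto simp: block_companion_def Let_def d[symmetric])
  also have "\<dots> = (\<Sum>j<r. if j = i then \<Sum>l<d. ?e l * v (j * d + l) else 0)"
    by (intro sum.cong) auto
  also have "\<dots> = (\<Sum>l<d. ?e l * v (i * d + l))"
    using i by simp
  also have "\<dots> = (if Suc k < d then v (i * d + Suc k) else - (\<Sum>l<d. coeff Q l * v (i * d + l)))"
  proof (cases "Suc k < d")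
    case True
    then have "(\<Sum>l<d. ?e l * v (i * d + l)) = (\<Sum>l<d. if l = Suc k then v (i * d + l) else 0)"
      by (intro sum.cong) auto
    then show ?thesis using True by simp
  qed (simp add: sum_negf)
  finally show ?thesis .
qed

lemma poly_monic_altdef:
  fixes Q :: "complex poly"
  assumes "monic Q"
  shows "poly Q z = (\<Sum>l<degree Q. coeff Q l * z ^ l) + z ^ degree Q"
proof -
  have "{..degree Q} = insert (degree Q) {..<degree Q}" by auto
  then show ?thesis using assms by (simp add: poly_altdef add.commute)
qed

text \<open>In every block an eigenvector is a multiple of \<open>(1, z, ..., z ^ (d - 1))\<close>,
  and the last row then says that \<open>poly Q z\<close> annihilates the multiplier.\<close>

lemma spectrum_block_companion:
  assumes Q: "monic Q" "degree Q > 0" and r: "r > 0"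
  shows "spectrum (block_companion r Q) = {z. poly Q z = 0}"
proof -
  define d where "d = degree Q"
  define A where "A = block_companion r Q"
  have A: "A \<in> carrier_mat (r * d) (r * d)"
    using block_companion_carrier by (simp add: A_def d_def)
  have d0: "d > 0" using Q by (simp add: d_def)
  have mv: "(A *\<^sub>v v) $ (i * d + k) =
      (if Suc k < d then v $ (i * d + Suc k) else - (\<Sum>l<d. coeff Q l * v $ (i * d + l)))"
    if "v \<in> carrier_vec (r * d)" "i < r" "k < d" for v i k
    using that A mult_add_less_mult[of i r k d] block_companion_row[OF d_def that(2,3), of "($) v"]
    by (auto simp: scalar_prod_def A_def atLeast0LessThan)
  have "eigenvalue A z \<longleftrightarrow> poly Q z = 0" for z
  proof
    assume "eigenvalue A z"
    then obtain v where v: "v \<in> carrier_vec (r * d)" "v \<noteq> 0\<^sub>v (r * d)" "A *\<^sub>v v = z \<cdot>\<^sub>v v"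
      using A unfolding eigenvalue_def eigenvector_def by auto
    have ev: "(if Suc k < d then v $ (i * d + Suc k) else - (\<Sum>l<d. coeff Q l * v $ (i * d + l))) =
        z * v $ (i * d + k)" if "i < r" "k < d" for i k
      using mv[OF v(1) that] v(1) mult_add_less_mult[OF that] unfolding v(3) by simp
    \<comment> \<open>The shift rows give the recursion for the powers of \<open>z\<close>.\<close>
    have pow: "v $ (i * d + k) = z ^ k * v $ (i * d)" if i: "i < r" and "k < d" for i k
      using \<open>k < d\<close>
    proof (induction k)
      case (Suc k)
      then show ?case using ev[OF i, of k] by simp
    qed simp
    show "poly Q z = 0"
    proof (rule ccontr)
      assume nz: "poly Q z \<noteq> 0"
      have "v $ (i * d) = 0" if i: "i < r" for i
      proof -
        \<comment> \<open>The last row of block \<open>i\<close>, at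
          \<open>k = d - 1\<close>.\<close>
        have "- (\<Sum>l<d. coeff Q l * v $ (i * d + l)) = z * v $ (i * d + (d - 1))"
          using ev[OF i, of "d - 1"] d0 by simp
        moreover have "(\<Sum>l<d. coeff Q l * v $ (i * d + l)) = (\<Sum>l<d. coeff Q l * z ^ l) * v $ (i * d)"
          using pow[OF i] by (simp add: sum_distrib_right mult.assoc)
        moreover have "z * v $ (i * d + (d - 1)) = z ^ d * v $ (i * d)"
          using pow[OF i, of "d - 1"] d0 by (cases d) auto
        ultimately have "poly Q z * v $ (i * d) = 0"
          unfolding poly_monic_altdef[OF Q(1)] d_def[symmetric] distrib_right by (metis ab_left_minus add.commute)
        then show ?thesis using nz by simp
      qed
      then have "v $ s = 0" if "s < r * d" for s
        using pow that by (elim mult_add_less_mult_cases) simp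
      then have "v = 0\<^sub>v (r * d)" using v(1) by (intro eq_vecI) auto
      then show False using v(2) by simp
    qed
  next
    assume root: "poly Q z = 0"
    \<comment> \<open>The vector of powers, repeated in every block; its first entry is
      \<open>1\<close>.\<close>
    define v where "v = vec (r * d) (\<lambda>s. z ^ (s mod d))"
    have v: "v \<in> carrier_vec (r * d)" by (simp add: v_def)
    have vi: "v $ (i * d + k) = z ^ k" if "i < r" "k < d" for i k
      using that mult_add_less_mult[OF that] by (simp add: v_def)
    have "v $ (0 * d + 0) \<noteq> 0\<^sub>v (r * d) $ (0 * d + 0)"
      using vi[of 0 0] r d0 by simp
    then have "v \<noteq> 0\<^sub>v (r * d)" by metis
    moreover have "A *\<^sub>v v = z \<cdot>\<^sub>v v"
    proof (rule eq_vecI)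
      fix s assume "s < dim_vec (z \<cdot>\<^sub>v v)"
      then have s: "s < r * d" using v by simp
      then obtain i k where ik: "i < r" "k < d" "s = i * d + k" by (rule mult_add_less_mult_cases)
      have "- (\<Sum>l<d. coeff Q l * v $ (i * d + l)) = z ^ d"
        using root ik unfolding poly_monic_altdef[OF Q(1)] d_def[symmetric]
        by (simp add: vi add_eq_0_iff)
      moreover have "z ^ d = z * z ^ k" if "\<not> Suc k < d"
        using that ik by (cases "d = Suc k") simp_all
      ultimately show "(A *\<^sub>v v) $ s = (z \<cdot>\<^sub>v v) $ s"
        using s v ik mv[OF v ik(1,2)] vi[OF ik(1), of k] vi[OF ik(1), of "Suc k"]
        by (cases "Suc k < d") simp_all
    qed (use A v in auto)
    ultimately show "eigenvalue A z"
      using A v unfolding eigenvalue_def eigenvector_def by auto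
  qed
  then show ?thesis unfolding spectrum_def A_def by auto
qed

section \<open>The transfer function of the realization\<close>

text \<open>The resolvent never has to be computed: it suffices to exhibit a solution
  \<open>X\<close> of the linear system, since off the spectrum the determinant is nonzero and
  \<open>mat_inverse\<close> returns an actual inverse.\<close>

lemma resolvent_mult_eq:
  fixes A :: "complex mat"
  assumes A: "A \<in> carrier_mat n n" and C: "C \<in> carrier_mat l n" and X: "X \<in> carrier_mat n m"
    and z: "z \<notin> spectrum A" and B: "(z \<cdot>\<^sub>m 1\<^sub>m n - A) * X = B"
  shows "C * the (mat_inverse (z \<cdot>\<^sub>m 1\<^sub>m n - A)) * B = C * X"
proof -
  let ?M = "z \<cdot>\<^sub>m 1\<^sub>m n - A"
  have M: "?M \<in> carrier_mat n n" using A by auto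
  have "det ?M \<noteq> 0"
  proof
    assume "det ?M = 0"
    moreover have "?M = (- 1) \<cdot>\<^sub>m char_matrix A z"
      using A by (intro eq_matI) (auto simp: char_matrix_def)
    ultimately have "det (char_matrix A z) = 0" by (simp add: det_smult)
    then show False using z eigenvalue_det[OF A] by (simp add: spectrum_def)
  qed
  then have "?M \<in> Units (ring_mat TYPE(complex) n ())"
    by (rule det_non_zero_imp_unit[OF M])
  then obtain R where "mat_inverse ?M = Some R"
    using mat_inverse(1)[OF M, of "()"] by (cases "mat_inverse ?M") auto
  moreover from mat_inverse(2)[OF M this] have R: "R * ?M = 1\<^sub>m n" "R \<in> carrier_mat n n" by auto
  have "C * R * B = C * (R * ?M * X)"
    unfolding B[symmetric] assoc_mult_mat[OF R(2) M X]
    using M X by (intro assoc_mult_mat[OF C R(2)]) (rule mult_carrier_mat)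
  ultimately show ?thesis using R X by simp
qed

definition block_input :: "nat \<Rightarrow> complex poly \<Rightarrow> complex mat" where
  "block_input r Q = (let d = degree Q in mat (r * d) r (\<lambda>(s, j).
     if s div d = j \<and> Suc (s mod d) = d then 1 else 0))"

text \<open>For monic \<open>Q\<close>, subtracting this multiple of \<open>Q\<close> removes the
  coefficient of degree \<open>d\<close>, so when \<open>degree (P i j) \<le> d\<close> the
  \<open>d\<close> remaining coefficients determine the polynomial.\<close>

definition block_output :: "nat \<Rightarrow> nat \<Rightarrow> (nat \<Rightarrow> nat \<Rightarrow> complex poly) \<Rightarrow> complex poly \<Rightarrow> complex mat" where
  "block_output l r P Q = (let d = degree Q in mat l (r * d) (\<lambda>(i, t).
     coeff (P i (t div d) - Polynomial.smult (coeff (P i (t div d)) d) Q) (t mod d)))"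

text \<open>For monic \<open>Q\<close> with \<open>degree (P i j) \<le> degree Q\<close> this is the
  value at infinity of the quotients; it is \<open>0\<close> where the inequality is strict.\<close>

definition block_feedthrough :: "nat \<Rightarrow> nat \<Rightarrow> (nat \<Rightarrow> nat \<Rightarrow> complex poly) \<Rightarrow> complex poly \<Rightarrow> complex mat" where
  "block_feedthrough l r P Q = mat l r (\<lambda>(i, j). coeff (P i j) (degree Q))"

text \<open>The resolvent applied to the input matrix has the powers of \<open>z\<close> over
  \<open>poly Q z\<close> as its blocks. Pairing them with the coefficients in the output matrix
  gives the quotient minus its value at infinity, which the feedthrough restores.\<close>

lemma block_companion_realizes:
  assumes Q: "monic Q" "degree Q > 0" and r: "r > 0" and z: "poly Q z \<noteq> 0"
    and deg: "\<And>i j. i < l \<Longrightarrow> j < r \<Longrightarrow> degree (P i j) \<le> degree Q"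
  shows "block_feedthrough l r P Q + block_output l r P Q *
      the (mat_inverse (z \<cdot>\<^sub>m 1\<^sub>m (r * degree Q) - block_companion r Q)) * block_input r Q =
    mat l r (\<lambda>(i, j). poly (P i j) z / poly Q z)"
proof -
  define d where "d = degree Q"
  define A where "A = block_companion r Q"
  define C where "C = block_output l r P Q"
  \<comment> \<open>\<open>X\<close> is the product of the resolvent with the input matrix.\<close>
  define X where "X = mat (r * d) r (\<lambda>(s, j). if s div d = j then z ^ (s mod d) / poly Q z else 0)"
  have A: "A \<in> carrier_mat (r * d) (r * d)"
    using block_companion_carrier by (simp add: A_def d_def)
  have X: "X \<in> carrier_mat (r * d) r" by (simp add: X_def)
  have C: "C \<in> carrier_mat l (r * d)" by (simp add: C_def block_output_def d_def Let_def)
  have Xi: "X $$ (i * d + k, j) = (if i = j then z ^ k / poly Q z else 0)"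
    if "i < r" "k < d" "j < r" for i j k
    using that mult_add_less_mult[of i r k d] by (simp add: X_def)
  have eq: "(z \<cdot>\<^sub>m 1\<^sub>m (r * d) - A) * X = block_input r Q"
  proof (rule eq_matI)
    fix s j assume "s < dim_row (block_input r Q)" "j < dim_col (block_input r Q)"
    then have s: "s < r * d" and j: "j < r" by (simp_all add: block_input_def d_def Let_def)
    from s obtain i k where ik: "i < r" "k < d" "s = i * d + k" by (rule mult_add_less_mult_cases)
    have "(A * X) $$ (s, j) = (\<Sum>t<r * d. A $$ (s, t) * X $$ (t, j))"
      using A X s j by (auto simp: scalar_prod_def atLeast0LessThan)
    also have "\<dots> = (if Suc k < d then X $$ (i * d + Suc k, j)
        else - (\<Sum>l<d. coeff Q l * X $$ (i * d + l, j)))"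
      unfolding A_def ik(3) by (rule block_companion_row[OF d_def ik(1,2)])
    finally have AX: "(A * X) $$ (s, j) = \<dots>" .
    have sum: "(\<Sum>l<d. coeff Q l * X $$ (i * d + l, j)) =
        (if i = j then (poly Q z - z ^ d) / poly Q z else 0)"
      using ik j by (simp add: Xi poly_monic_altdef[OF Q(1)] d_def[symmetric] sum_divide_distrib)
    have "(z \<cdot>\<^sub>m 1\<^sub>m (r * d) - A) * X = z \<cdot>\<^sub>m X - A * X"
      using A X by (simp add: minus_mult_distrib_mat[of _ "r * d" "r * d"] mult_smult_assoc_mat[of _ "r * d" "r * d"])
    then have "((z \<cdot>\<^sub>m 1\<^sub>m (r * d) - A) * X) $$ (s, j) = z * X $$ (s, j) - (A * X) $$ (s, j)"
      using A X s j by simp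
    also have "\<dots> = (if i = j \<and> Suc k = d then 1 else 0)"
    proof (cases "Suc k < d")
      case True
      then show ?thesis using ik j Xi[of i "Suc k" j] unfolding AX by (simp add: Xi)
    next
      case False
      \<comment> \<open>In the last row of block \<open>j\<close> the terms
        \<open>z ^ d / poly Q z\<close> and \<open>(poly Q z - z ^ d) / poly Q z\<close> add up to
        \<open>1\<close>.\<close>
      then have "d = Suc k" using ik by simp
      then show ?thesis
        using ik j z Xi[of i k j] unfolding AX sum by (auto simp: diff_divide_distrib)
    qed
    also have "\<dots> = block_input r Q $$ (s, j)"
      using s j ik by (simp add: block_input_def d_def[symmetric] Let_def)
    finally show "((z \<cdot>\<^sub>m 1\<^sub>m (r * d) - A) * X) $$ (s, j) = block_input r Q $$ (s, j)" .
  qed (use A X in \<open>auto simp: block_input_def d_def Let_def\<close>)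
  have "(C * X) $$ (i, j) = poly (P i j) z / poly Q z - coeff (P i j) d" if i: "i < l" and j: "j < r" for i j
  proof -
    define p where "p = P i j - Polynomial.smult (coeff (P i j) d) Q"
    have "degree p \<le> d" unfolding p_def d_def
      using deg[OF i j] by (intro degree_diff_le degree_smult_le) auto
    \<comment> \<open>Monicity makes the top coefficients cancel, so the sum below stops before
      \<open>d\<close>.\<close>
    moreover have "coeff p d = 0" using Q(1) by (simp add: p_def d_def)
    ultimately have "poly p z = (\<Sum>k<d. coeff p k * z ^ k)"
    proof -
      have "poly p z = (\<Sum>k\<le>d. coeff p k * z ^ k)"
        using \<open>degree p \<le> d\<close> unfolding poly_altdef
        by (intro sum.mono_neutral_left) (auto simp: coeff_eq_0)
      also have "{..d} = insert d {..<d}" by auto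
      finally show ?thesis using \<open>coeff p d = 0\<close> by simp
    qed
    moreover have "(C * X) $$ (i, j) = (\<Sum>t<r * d. C $$ (i, t) * X $$ (t, j))"
      using C X i j by (auto simp: scalar_prod_def atLeast0LessThan)
    moreover have "\<dots> = (\<Sum>m<r. if m = j then \<Sum>k<d. coeff p k * z ^ k / poly Q z else 0)"
      unfolding sum_lessThan_mult using i j mult_add_less_mult[of _ r _ d]
      by (intro sum.cong) (auto simp: Xi C_def block_output_def Let_def p_def d_def[symmetric])
    ultimately have "(C * X) $$ (i, j) = poly p z / poly Q z"
      using j by (simp add: sum_divide_distrib)
    then show ?thesis using z by (simp add: p_def field_simps)
  qed
  moreover have "z \<notin> spectrum A"
    using z spectrum_block_companion[OF Q r] by (simp add: A_def)
  then have "C * the (mat_inverse (z \<cdot>\<^sub>m 1\<^sub>m (r * d) - A)) * block_input r Q = C * X"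
    by (rule resolvent_mult_eq[OF A C X _ eq])
  ultimately show ?thesis
    unfolding A_def[symmetric] C_def[symmetric] d_def[symmetric]
    using C X by (intro eq_matI) (auto simp: block_feedthrough_def d_def)
qed

section \<open>Symmetry of the four matrices\<close>

text \<open>Adding \<open>p * degree Q\<close> to an index adds \<open>p\<close> to its block number
  and keeps the position. All blocks are equal, and a block number below \<open>p\<close> never
  meets one shifted by \<open>p\<close>, so the off-diagonal halves vanish.\<close>

lemma sharp_symmetric_block_companion:
  assumes "degree Q > 0"
  shows "sharp_symmetric (p * degree Q) (p * degree Q) (block_companion (2 * p) Q)"
proof -
  have "s div degree Q < p" if "s < p * degree Q" for s
    using that assms by (simp add: div_less_iff_less_mult)
  then show ?thesis
    using assms block_companion_carrier[of "2 * p" Q] unfolding sharp_symmetric_iff_entries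
    by (force simp: block_companion_def Let_def mult.assoc)
qed

lemma sharp_symmetric_block_input:
  assumes "degree Q > 0"
  shows "sharp_symmetric (p * degree Q) p (block_input (2 * p) Q)"
proof -
  have "s div degree Q < p" if "s < p * degree Q" for s
    using that assms by (simp add: div_less_iff_less_mult)
  then show ?thesis
    using assms unfolding sharp_symmetric_iff_entries
    by (force simp: block_input_def Let_def mult.assoc)
qed

text \<open>Entries depend linearly on \<open>P\<close>, so the relations between the polynomials
  pass to the coefficients.\<close>

lemma sharp_symmetric_block_output:
  assumes "degree Q > 0"
    and P: "\<And>i j. i < p \<Longrightarrow> j < p \<Longrightarrow> P (i + p) (j + p) = P i j \<and> P (i + p) j = - P i (j + p)"
  shows "sharp_symmetric p (p * degree Q) (block_output (2 * p) (2 * p) P Q)"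
proof -
  have "s div degree Q < p" if "s < p * degree Q" for s
    using that assms by (simp add: div_less_iff_less_mult)
  then show ?thesis
    using assms(1) P[unfolded add.commute[of _ p]] unfolding sharp_symmetric_iff_entries add.commute[of _ p]
    by (auto simp: block_output_def Let_def mult.assoc)
qed

lemma sharp_symmetric_block_feedthrough:
  assumes P: "\<And>i j. i < p \<Longrightarrow> j < p \<Longrightarrow> P (i + p) (j + p) = P i j \<and> P (i + p) j = - P i (j + p)"
  shows "sharp_symmetric p p (block_feedthrough (2 * p) (2 * p) P Q)"
  using P unfolding sharp_symmetric_iff_entries by (auto simp: block_feedthrough_def)

text \<open>\<open>Q * (P - R)\<close> vanishes everywhere. This lifts the pointwise symmetry of
  \<open>f\<close> to identities between numerators.\<close>

lemma poly_eqI_off_roots: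
  fixes P R Q :: "complex poly"
  assumes "Q \<noteq> 0" and "\<And>z. poly Q z \<noteq> 0 \<Longrightarrow> poly P z = poly R z"
  shows "P = R"
proof -
  have "poly (Q * (P - R)) z = 0" for z
    using assms(2)[of z] by auto
  then have "Q * (P - R) = 0"
    using poly_all_0_iff_0 by blast
  then show ?thesis using assms(1) by simp
qed

theorem theorem4p12:
  fixes p :: nat and f :: "complex \<Rightarrow> complex mat"
  assumes "rational_mat_fun (2 * p) (2 * p) f"
    and "analytic_at_infinity_mat (2 * p) (2 * p) f"
    and "sharp_symmetric_fun p f"
    and "regular_on_circle (2 * p) (2 * p) f"
  shows "\<exists>n A B C D. n > 0 \<and>
           sharp_symmetric n n A \<and> sharp_symmetric n p B \<and>
           sharp_symmetric p n C \<and> sharp_symmetric p p D \<and>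
           realization (2 * n) f A B C D \<and>
           spectrum A \<inter> sphere 0 1 = {}"
proof (cases "p = 0")
  case True
  \<comment> \<open>The general construction would give \<open>n = 0\<close> here. Instead the state
    matrix is the zero matrix of size \<open>2\<close>, with spectrum \<open>{0}\<close>, and inputs
    and outputs are empty.\<close>
  define A where "A = block_companion 2 [:0, 1:]"
  have "sharp_symmetric 1 1 A"
    using sharp_symmetric_block_companion[of "[:0, 1:]" 1] by (simp add: A_def)
  moreover have "spectrum A = {0}"
    using spectrum_block_companion[of "[:0, 1:]" 2] by (auto simp: A_def)
  moreover have "f z \<in> carrier_mat 0 0" for z
    using assms(1) True by (simp add: rational_mat_fun_def)
  then have dims: "dim_row (f z) = 0" "dim_col (f z) = 0" for z
    by (meson carrier_matD)+
  then have "realization (2 * 1) f A (0\<^sub>m 2 0) (0\<^sub>m 0 2) (0\<^sub>m 0 0)"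
    unfolding realization_def by (intro allI impI eq_matI) (simp_all add: dims)
  ultimately show ?thesis
    unfolding True
    by (intro exI[of _ 1] exI[of _ A] exI[of _ "0\<^sub>m 2 0"] exI[of _ "0\<^sub>m 0 2"] exI[of _ "0\<^sub>m 0 0"] conjI)
      (simp_all add: sharp_symmetric_iff_entries)
next
  case False
  obtain P Q where Q: "monic Q" "degree Q > 0"
    and deg: "\<And>i j. i < 2 * p \<Longrightarrow> j < 2 * p \<Longrightarrow> degree (P i j) \<le> degree Q"
    and f: "\<And>i j z. i < 2 * p \<Longrightarrow> j < 2 * p \<Longrightarrow> poly Q z \<noteq> 0 \<Longrightarrow>
      f z $$ (i, j) = poly (P i j) z / poly Q z"
    and circle: "\<And>z. z \<in> sphere 0 1 \<Longrightarrow> poly Q z \<noteq> 0"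
    using rational_mat_fun_common_denominator[OF assms(1,2,4)] by metis
  have fc: "f z \<in> carrier_mat (2 * p) (2 * p)" for z
    using assms(1) by (simp add: rational_mat_fun_def)
  have sym: "sharp_symmetric p p (f z)" if "poly Q z \<noteq> 0" for z
  proof -
    have "\<not> is_pole (\<lambda>w. f w $$ (i, j)) z" if "i < 2 * p" "j < 2 * p" for i j
      using rational_not_is_pole[OF f] that \<open>poly Q z \<noteq> 0\<close> by blast
    then show ?thesis
      using assms(3) unfolding sharp_symmetric_fun_def pole_mat_fun_def by blast
  qed
  have P: "P (i + p) (j + p) = P i j \<and> P (i + p) j = - P i (j + p)" if ij: "i < p" "j < p" for i j
  proof -
    have lt: "i < 2 * p" "i + p < 2 * p" "j < 2 * p" "j + p < 2 * p" using ij by auto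
    have "poly (P (i + p) (j + p)) z = poly (P i j) z"
      "poly (P (i + p) j) z = poly (- P i (j + p)) z" if z: "poly Q z \<noteq> 0" for z
      using sym[OF z] ij lt z by (auto simp: sharp_symmetric_iff_entries f eq_neg_iff_add_eq_0 simp flip: add_divide_distrib)
    moreover have "Q \<noteq> 0" using Q by auto
    ultimately show ?thesis using poly_eqI_off_roots by blast
  qed
  \<comment> \<open>There is one block of size \<open>degree Q\<close> for each of the
    \<open>2 * p\<close> inputs; the first \<open>n\<close> states are exactly the blocks numbered
    below \<open>p\<close>.\<close>
  define n where "n = p * degree Q"
  have n: "2 * n = 2 * p * degree Q" by (simp add: n_def)
  let ?A = "block_companion (2 * p) Q" and ?B = "block_input (2 * p) Q"
  let ?C = "block_output (2 * p) (2 * p) P Q" and ?D = "block_feedthrough (2 * p) (2 * p) P Q"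
  have spec: "spectrum ?A = {z. poly Q z = 0}"
    using False by (intro spectrum_block_companion Q) simp
  \<comment> \<open>By \<open>spec\<close> the points off the spectrum are the non-roots of
    \<open>Q\<close>, exactly where \<open>f\<close> is known to equal the quotients.\<close>
  have "realization (2 * n) f ?A ?B ?C ?D"
    unfolding realization_def spec n
  proof (intro allI impI)
    fix z assume "z \<notin> {z. poly Q z = 0}"
    then have z: "poly Q z \<noteq> 0" by simp
    have "f z = mat (2 * p) (2 * p) (\<lambda>(i, j). poly (P i j) z / poly Q z)"
      using fc[of z] f[OF _ _ z] by (intro eq_matI) auto
    then show "f z = ?D + ?C * the (mat_inverse (z \<cdot>\<^sub>m 1\<^sub>m (2 * p * degree Q) - ?A)) * ?B"
      using block_companion_realizes[OF Q _ z deg] False by simp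
  qed
  moreover have "spectrum ?A \<inter> sphere 0 1 = {}"
    using circle unfolding spec by auto
  moreover have "n > 0" using False Q by (simp add: n_def)
  ultimately show ?thesis
    using sharp_symmetric_block_companion[OF Q(2)] sharp_symmetric_block_input[OF Q(2)]
      sharp_symmetric_block_output[where P = P, OF Q(2) P]
      sharp_symmetric_block_feedthrough[where P = P, OF P]
    unfolding n_def by blast
qed

end
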